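(* Let $H_n$ denote $\mathbb{R}^n$ or $\mathbb{C}^n$, and let $F=\{f_i\}_{i\in I}\subseteq H_n$ be a finite frame of nonzero vectors. Then for any integer $\ell$ with $2\le\ell\le n$ there exists a rank $\ell$ orthogonal projection $\pi:H_n\to H_n$ such that $\pi F=\{\pi f_i\}_{i\in I}\subseteq\pi(H_n)$ has the same factor poset (as a frame for $\pi(H_n)$) as $F$ (as a frame for $H_n$).
   Context: A frame for a finite-dimensional Hilbert space $H$ is a finite sequence $\{f_i\}_{i\in I}$ (repetitions allowed) spanning $H$. It is tight if there is $\lambda>0$ with $\sum_{i\in I}|\langle x,f_i\rangle|^2=\lambda\|x\|^2$ for all $x\in H$. The factor poset of a frame $F=\{f_i\}_{i\in I}$ for $H$ is $\mathbb{F}_F=\{J\subseteq I:\{f_j\}_{j\in J}\text{ is a tight frame for }H\}$, ordered by inclusion, with the convention $\emptyset\in\mathbb{F}_F$. *)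

theory Defs
  imports "HOL-Analysis.Analysis" "Jordan_Normal_Form.Conjugate"
begin

text \<open>
  The definitions are generic in the scalar field, so that they apply to both
  real and complex vectors: conjugation is the identity on the reals and
  complex conjugation on the complex numbers.  All linear-algebra notions are those
  over the scalar field itself (\<open>vec.span\<close>, \<open>vec.dim\<close>, linearity with respect to
  \<open>(*s)\<close>); the real-linear \<open>span\<close>, \<open>dim\<close>, \<open>linear\<close> and \<open>inner\<close>
  would be the wrong notions on complex vectors.
\<close>

definition hinner :: "'k::{conjugatable_field,real_normed_field} ^ 'n \<Rightarrow> 'k ^ 'n \<Rightarrow> 'k" where
  "hinner x y = (\<Sum>i\<in>UNIV. x $ i * conjugate (y $ i))"

text \<open>
  A sequence is given by an index set and a function on it, so repetitions are allowed.
  The ambient space \<open>V\<close> is a linear subspace of the coordinate space.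
\<close>

definition is_frame :: "('k::{conjugatable_field,real_normed_field} ^ 'n) set \<Rightarrow> 'i set \<Rightarrow> ('i \<Rightarrow> 'k ^ 'n) \<Rightarrow> bool"
  where "is_frame V I f \<longleftrightarrow> finite I \<and> vec.span (f ` I) = V"

definition is_tight_frame :: "('k::{conjugatable_field,real_normed_field} ^ 'n) set \<Rightarrow> 'i set \<Rightarrow> ('i \<Rightarrow> 'k ^ 'n) \<Rightarrow> bool"
  where "is_tight_frame V I f \<longleftrightarrow> is_frame V I f \<and>
    (\<exists>c::real. c > 0 \<and> (\<forall>x\<in>V. (\<Sum>i\<in>I. (norm (hinner x (f i)))\<^sup>2) = c * (norm x)\<^sup>2))"

text \<open>
  The order on the factor poset is inclusion, so two factor posets over the same
  index set are the same iff they are equal as families of subsets.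
\<close>

definition factor_poset :: "('k::{conjugatable_field,real_normed_field} ^ 'n) set \<Rightarrow> 'i set \<Rightarrow> ('i \<Rightarrow> 'k ^ 'n) \<Rightarrow> 'i set set"
  where "factor_poset V I f = {J. J \<subseteq> I \<and> (J = {} \<or> is_tight_frame V J f)}"

definition orthogonal_projection :: "('k::{conjugatable_field,real_normed_field} ^ 'n \<Rightarrow> 'k ^ 'n) \<Rightarrow> bool"
  where "orthogonal_projection p \<longleftrightarrow>
    Vector_Spaces.linear (*s) (*s) p \<and> p \<circ> p = p \<and> (\<forall>x y. hinner (p x) y = hinner x (p y))"

end

theory Submission
  imports Defs
begin

text \<open>
  For a finite index set \<open>J\<close> let \<open>q\<^sub>J x\<close> be the sum of the squared moduli of the inner products
  of \<open>x\<close> with the vectors of \<open>J\<close>.  An orthogonal projection \<open>p\<close> is self-adjoint, so on its range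
  the form \<open>q\<^sub>J\<close> of the projected vectors is the restriction of \<open>q\<^sub>J\<close>.  Hence tight subsets stay
  tight, and the only task is to prevent a form \<open>q\<^sub>J\<close> that is not a multiple of the squared norm from
  becoming one on the range.  For such \<open>J\<close> there are \<open>x, y\<close> with
  \<open>q\<^sub>J x * (norm y)\<^sup>2 \<noteq> q\<^sub>J y * (norm x)\<^sup>2\<close>.  These inequations are polynomial along real
  lines and there are finitely many of them, so a single pair \<open>x, y\<close> satisfies them all; as
  \<open>2 \<le> l\<close>, the range can be chosen to contain this pair.
\<close>

subsection \<open>Scalars and the inner product\<close>

text \<open>Conjugation and norm come from unrelated classes. The axiom ties them together, so that
  one proof serves \<open>real\<close> and \<open>complex\<close>.\<close>

class rc_field = conjugatable_field + real_normed_field +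
  assumes mult_conjugate_scaleR: "a * conjugate a = (norm a)\<^sup>2 *\<^sub>R 1"

instance real :: rc_field
  by standard (simp add: power2_eq_square)

instance complex :: rc_field
  by standard (simp add: complex_norm_square[symmetric] scaleR_conv_of_real)

lemma mult_conjugate: "a * conjugate a = of_real ((norm (a::'k::rc_field))\<^sup>2)"
  by (simp only: mult_conjugate_scaleR of_real_def)

lemma conjugate_1 [simp]: "conjugate (1::'k::rc_field) = 1"
  using mult_conjugate[of "1::'k"] by simp

lemma conjugate_of_real [simp]: "conjugate (of_real t :: 'k::rc_field) = of_real t"
proof (cases "t = 0")
  case False
  then show ?thesis
    using mult_conjugate[of "of_real t :: 'k"] by (simp add: power2_eq_square)
qed simp

lemma hinner_add_left: "hinner (x + y) z = hinner x z + hinner y z"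
  by (simp add: hinner_def distrib_right sum.distrib)

lemma hinner_scale_left: "hinner (c *s x) z = c * hinner x z"
  by (simp add: hinner_def sum_distrib_left mult.assoc)

lemma hinner_diff_left: "hinner (x - y) z = hinner x z - hinner y z"
  by (simp add: hinner_def left_diff_distrib sum_subtractf)

lemma conjugate_hinner: "conjugate (hinner x y) = hinner y x"
  by (simp add: hinner_def sum_conjugate conjugate_dist_mul mult.commute)

lemma hinner_add_right: "hinner z (x + y) = hinner z x + hinner z y"
  by (metis conjugate_hinner hinner_add_left conjugate_dist_add)

lemma hinner_scale_right: "hinner z (c *s x) = conjugate c * hinner z x"
  by (metis conjugate_hinner hinner_scale_left conjugate_dist_mul)

lemma norm_vec_power2: "(norm (x :: 'a::real_normed_vector ^ 'n))\<^sup>2 = (\<Sum>i\<in>UNIV. (norm (x $ i))\<^sup>2)"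
  by (simp add: norm_vec_def L2_set_def sum_nonneg)

lemma hinner_self: "hinner x x = of_real ((norm (x :: 'k::rc_field ^ 'n))\<^sup>2)"
  by (simp add: hinner_def mult_conjugate norm_vec_power2)

lemma hinner_self_eq_0_iff: "hinner x x = 0 \<longleftrightarrow> (x :: 'k::rc_field ^ 'n) = 0"
  by (simp add: hinner_self)

lemma hinner_scaleR_left:
  "hinner (t *\<^sub>R x) (z :: 'k::rc_field ^ 'n) = of_real t * hinner x z"
  by (simp add: hinner_def sum_distrib_left mult.assoc scaleR_conv_of_real[where 'a='k])

subsection \<open>Orthogonal projections\<close>

lemma linear_rank_one_update:
  fixes p :: "'k::{conjugatable_field,real_normed_field} ^ 'n \<Rightarrow> 'k ^ 'n"
  assumes "Vector_Spaces.linear (*s) (*s) p"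
  shows "Vector_Spaces.linear (*s) (*s) (\<lambda>x. p x + (hinner x u / c) *s u)"
proof -
  interpret p: Vector_Spaces.linear "(*s)" "(*s)" p by fact
  show ?thesis
    by (unfold_locales)
      (simp_all add: p.add p.scale hinner_add_left hinner_scale_left add_divide_distrib
        vec.scale_left_distrib vec.scale_right_distrib)
qed

text \<open>One Gram-Schmidt step per vector of a finite spanning set.\<close>

lemma orthogonal_projection_onto_span:
  fixes S :: "('k::rc_field ^ 'n) set"
  assumes "finite S"
  shows "\<exists>p. orthogonal_projection p \<and> range p = vec.span S"
  using assms
proof induction
  case empty
  have "orthogonal_projection (\<lambda>x. 0 :: 'k ^ 'n)"
    unfolding orthogonal_projection_def
    by (auto simp: hinner_def vec.linear_0 fun_eq_iff intro!: vec.linear_zero)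
  then show ?case
    by (intro exI[of _ "\<lambda>x. 0"]) auto
next
  case (insert b S)
  then obtain p :: "'k ^ 'n \<Rightarrow> 'k ^ 'n"
    where p: "orthogonal_projection p" and rp: "range p = vec.span S"
    by blast
  interpret p: Vector_Spaces.linear "(*s)" "(*s)" p
    using p by (simp add: orthogonal_projection_def)
  have pp: "p (p x) = p x" for x
    using p by (simp add: orthogonal_projection_def fun_eq_iff)
  have sa: "hinner (p x) y = hinner x (p y)" for x y
    using p by (simp add: orthogonal_projection_def)
  \<comment> \<open>The part of \<open>b\<close> orthogonal to \<open>range p\<close>; it can
    replace \<open>b\<close> because \<open>p b\<close> already lies in the span of
    \<open>S\<close>.\<close>
  define u where "u = b - p b"
  have span: "vec.span (insert b S) = vec.span (insert u S)"
    by (rule vec.eq_span_insert_eq) (use rp in \<open>auto simp: u_def\<close>)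
  show ?case
  proof (cases "u = 0")
    case True
    then show ?thesis
      using p rp span vec.span_insert_0 by metis
  next
    case False
    have pu: "p u = 0"
      by (simp add: u_def p.diff pp)
    have orth: "hinner (p x) u = 0" for x
      using sa[of x u] pu by (simp add: hinner_def)
    have uu: "hinner u u \<noteq> 0"
      using False by (simp add: hinner_self_eq_0_iff)
    \<comment> \<open>Adds to \<open>p\<close> the orthogonal projection onto the line through
      \<open>u\<close>.\<close>
    define q where "q x = p x + (hinner x u / hinner u u) *s u" for x
    have "hinner (q x) y = hinner x (q y)" for x y
    proof -
      \<comment> \<open>\<open>hinner u u\<close> is its own conjugate, so conjugation only affects
        the numerator.\<close>
      have "conjugate (hinner y u / hinner u u) * hinner u u = conjugate (hinner y u)"
        using uu conjugate_hinner[of u u]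
        by (metis conjugate_dist_mul nonzero_eq_divide_eq)
      then have "conjugate (hinner y u / hinner u u) = hinner u y / hinner u u"
        using uu by (simp add: conjugate_hinner nonzero_eq_divide_eq)
      then show ?thesis
        by (simp add: q_def hinner_add_left hinner_add_right hinner_scale_left
            hinner_scale_right sa)
    qed
    moreover have "q (q x) = q x" for x
      using uu by (simp add: q_def p.add p.scale pp pu hinner_add_left hinner_scale_left orth)
    moreover have "Vector_Spaces.linear (*s) (*s) q"
      unfolding q_def by (rule linear_rank_one_update) (rule p.linear_axioms)
    ultimately have "orthogonal_projection q"
      by (simp add: orthogonal_projection_def fun_eq_iff)
    moreover have "range q = vec.span (insert u S)"
    proof (intro equalityI subsetI)
      fix x assume "x \<in> range q"
      then obtain y where "x = q y"
        by blast
      then have "x - (hinner y u / hinner u u) *s u = p y"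
        by (simp add: q_def)
      then show "x \<in> vec.span (insert u S)"
        using rp by (auto simp: vec.span_breakdown_eq)
    next
      fix x assume "x \<in> vec.span (insert u S)"
      then obtain k where "x - k *s u \<in> range p"
        by (auto simp: vec.span_breakdown_eq rp)
      then obtain y where x: "x = p y + k *s u"
        by (metis diff_add_cancel imageE)
      have "q x = x"
        using uu by (simp add: q_def x p.add p.scale pp pu hinner_add_left hinner_scale_left orth)
      then show "x \<in> range q"
        by (metis rangeI)
    qed
    ultimately show ?thesis
      using span by metis
  qed
qed

lemma orthogonal_projection_fixes_range:
  assumes "orthogonal_projection p" "x \<in> range p"
  shows "p x = x"
  using assms by (auto simp: orthogonal_projection_def fun_eq_iff)

text \<open>Self-adjointness moves \<open>p\<close> over to \<open>x\<close>, which it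
  fixes.\<close>

lemma hinner_projected:
  assumes "orthogonal_projection p" "x \<in> range p"
  shows "hinner x (p y) = hinner x y"
  using assms orthogonal_projection_fixes_range[OF assms]
  by (metis orthogonal_projection_def)

lemma orthogonal_projection_span_image:
  assumes "orthogonal_projection p" "vec.span (f ` J) = UNIV"
  shows "vec.span ((p \<circ> f) ` J) = range p"
proof -
  interpret p: Vector_Spaces.linear "(*s)" "(*s)" p
    using assms by (simp add: orthogonal_projection_def)
  show ?thesis
    using assms p.span_image[of "f ` J"] by (simp add: image_comp)
qed

text \<open>A maximal independent subset of \<open>{x, y}\<close> has at most two elements, hence at
  most \<open>l\<close>. A set of size \<open>l\<close> between it and a basis extending it spans
  the range.\<close>

lemma exists_projection_range_contains:
  fixes x y :: "'k::rc_field ^ 'n"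
  assumes "2 \<le> l" "l \<le> CARD('n)"
  obtains p where "orthogonal_projection p" "vec.dim (range p) = l" "x \<in> range p" "y \<in> range p"
proof -
  obtain B where B: "B \<subseteq> {x, y}" "vec.independent B" "{x, y} \<subseteq> vec.span B"
    by (rule vec.maximal_independent_subset)
  have "card B \<le> card {x, y}"
    by (rule card_mono) (use B in auto)
  also have "\<dots> \<le> 2"
    by (simp add: card_insert_if)
  finally have Bl: "card B \<le> l"
    using assms by simp
  define C where "C = vec.extend_basis B"
  have C: "B \<subseteq> C" "vec.independent C" "vec.span C = UNIV"
    using B by (auto simp: C_def vec.extend_basis_superset vec.independent_extend_basis)
  then have finC: "finite C"
    using vec.finiteI_independent by blast
  have "card C = CARD('n)"
    using vec.dim_eq_card[of C UNIV] C vec_dim_card[where 'a='k and 'n='n] by simp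
  then obtain D where D: "B \<subseteq> D" "D \<subseteq> C" "card D = l"
    using exists_subset_between[of B l C] Bl C finC assms by auto
  then have "finite D" "vec.independent D"
    using finC C finite_subset vec.independent_mono by blast+
  moreover obtain p :: "'k ^ 'n \<Rightarrow> 'k ^ 'n"
    where "orthogonal_projection p" "range p = vec.span D"
    using orthogonal_projection_onto_span[OF \<open>finite D\<close>] by blast
  moreover have "{x, y} \<subseteq> vec.span D"
    using B D vec.span_mono by blast
  ultimately show thesis
    using that[of p] D by (simp add: vec.dim_eq_card_independent)
qed

subsection \<open>Separating finitely many forms\<close>

lemma real_polynomial_function_norm_line_power2:
  fixes a b :: "'k::rc_field"
  shows "real_polynomial_function (\<lambda>t. (norm (a + of_real t * b))\<^sup>2)"
proof -
  \<comment> \<open>This is twice the real part of \<open>a * conjugate b\<close>, written with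
    norms because the generic field has no real-part function.\<close>
  define c where "c = (norm (a + b))\<^sup>2 - (norm a)\<^sup>2 - (norm b)\<^sup>2"
  have c: "(of_real c :: 'k) = a * conjugate b + b * conjugate a"
    unfolding c_def of_real_diff mult_conjugate[symmetric]
    by (simp add: conjugate_dist_add algebra_simps)
  have "(norm (a + of_real t * b))\<^sup>2 = (norm a)\<^sup>2 + t * c + t * t * (norm b)\<^sup>2" for t
  proof -
    have "(of_real ((norm (a + of_real t * b))\<^sup>2) :: 'k)
        = of_real ((norm a)\<^sup>2 + t * c + t * t * (norm b)\<^sup>2)"
      unfolding of_real_add of_real_mult c mult_conjugate[symmetric]
      by (simp add: conjugate_dist_add conjugate_dist_mul algebra_simps)
    then show ?thesis
      by (simp only: of_real_eq_iff)
  qed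
  then show ?thesis
    by (simp only:)
      (intro real_polynomial_function.intros(3,4,2,1) bounded_linear_ident)
qed

lemma real_polynomial_function_finite_roots:
  assumes "real_polynomial_function h" "h s \<noteq> (0::real)"
  shows "finite {t::real. h t = 0}"
proof -
  obtain a n where h: "h = (\<lambda>x. \<Sum>i\<le>n. a i * x ^ i)"
    using assms(1) by (auto simp: real_polynomial_function_iff_sum)
  then have "\<exists>i\<le>n. a i \<noteq> 0"
    using assms(2) by (metis (no_types, lifting) atMost_iff mult_zero_left sum.neutral)
  then show ?thesis
    unfolding h by (auto simp: polyfun_finite_roots)
qed

text \<open>Induction on \<open>B\<close>: join a point that is good for the old functions to one
  that is good for the new function. On this line each function is a nonzero polynomial, so only
  finitely many parameters are bad.\<close>

lemma common_nonzero_of_polynomial_on_lines: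
  fixes h :: "'b \<Rightarrow> 'v::real_vector \<Rightarrow> real"
  assumes "finite B"
    and "\<And>b z d. b \<in> B \<Longrightarrow> real_polynomial_function (\<lambda>t. h b (z + t *\<^sub>R d))"
    and "\<And>b. b \<in> B \<Longrightarrow> \<exists>z. h b z \<noteq> 0"
  shows "\<exists>z. \<forall>b\<in>B. h b z \<noteq> 0"
  using assms
proof induction
  case (insert b B)
  then obtain z where z: "\<forall>c\<in>B. h c z \<noteq> 0"
    by auto
  from insert.prems(2)[of b] obtain w where w: "h b w \<noteq> 0"
    by auto
  define g where "g c t = h c (z + t *\<^sub>R (w - z))" for c t
  have "finite {t. g c t = 0}" if "c \<in> insert b B" for c
  proof (rule real_polynomial_function_finite_roots)
    show "real_polynomial_function (g c)"
      unfolding g_def using that by (rule insert.prems)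
    \<comment> \<open>Parameter 0 gives \<open>z\<close>, which is good for the old functions;
      parameter 1 gives \<open>w\<close>, which is good for \<open>b\<close>.\<close>
    show "g c (if c = b then 1 else 0) \<noteq> 0"
      using that z w by (auto simp: g_def)
  qed
  then have "finite (\<Union>c\<in>insert b B. {t. g c t = 0})"
    using insert.hyps by auto
  then obtain t where "t \<notin> (\<Union>c\<in>insert b B. {t. g c t = 0})"
    using ex_new_if_finite infinite_UNIV_char_0 by blast
  then show ?case
    by (auto simp: g_def)
qed simp

text \<open>The quadratic form of the frame operator of the subsequence indexed by
  \<open>J\<close>.\<close>

definition frame_form :: "('i \<Rightarrow> 'k::{conjugatable_field,real_normed_field} ^ 'n) \<Rightarrow> 'i set \<Rightarrow> 'k ^ 'n \<Rightarrow> real"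
  where "frame_form f J x = (\<Sum>i\<in>J. (norm (hinner x (f i)))\<^sup>2)"

lemma real_polynomial_function_frame_form_line:
  fixes f :: "'i \<Rightarrow> 'k::rc_field ^ 'n"
  assumes "finite J"
  shows "real_polynomial_function (\<lambda>t. frame_form f J (x + t *\<^sub>R d))"
  unfolding frame_form_def hinner_add_left hinner_scaleR_left
  using assms by (intro real_polynomial_function_sum real_polynomial_function_norm_line_power2)

lemma real_polynomial_function_norm_power2_line:
  fixes x d :: "'k::rc_field ^ 'n"
  shows "real_polynomial_function (\<lambda>t. (norm (x + t *\<^sub>R d))\<^sup>2)"
  unfolding norm_vec_power2 vector_add_component vector_scaleR_component
    scaleR_conv_of_real[where 'a='k]
  by (intro real_polynomial_function_sum real_polynomial_function_norm_line_power2) simp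

lemma common_separating_pair:
  fixes f :: "'i \<Rightarrow> 'k::rc_field ^ 'n"
  assumes "finite I"
  obtains x y where "\<And>J. J \<subseteq> I \<Longrightarrow> frame_form f J x * (norm y)\<^sup>2 = frame_form f J y * (norm x)\<^sup>2
    \<Longrightarrow> \<exists>c. \<forall>v. frame_form f J v = c * (norm v)\<^sup>2"
proof -
  \<comment> \<open>Comparing the two ratios by cross-multiplication keeps \<open>h J\<close>
    polynomial on lines of the product space, where the pair is a single point.\<close>
  define h where "h J z = frame_form f J (fst z) * (norm (snd z))\<^sup>2
    - frame_form f J (snd z) * (norm (fst z))\<^sup>2" for J z
  define B where "B = {J. J \<subseteq> I \<and> \<not> (\<exists>c. \<forall>v. frame_form f J v = c * (norm v)\<^sup>2)}"
  have "\<exists>z. \<forall>J\<in>B. h J z \<noteq> 0"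
  proof (rule common_nonzero_of_polynomial_on_lines)
    show "finite B"
      using assms by (simp add: B_def)
    fix J assume J: "J \<in> B"
    then have "finite J"
      using assms finite_subset by (auto simp: B_def)
    then show "real_polynomial_function (\<lambda>t. h J (z + t *\<^sub>R d))" for z d
      unfolding h_def fst_add snd_add fst_scaleR snd_scaleR
      by (intro real_polynomial_function_diff real_polynomial_function.intros(4)
          real_polynomial_function_frame_form_line real_polynomial_function_norm_power2_line)
    \<comment> \<open>Any nonzero vector would do. Its ratio is the only candidate for the constant,
      and membership in \<open>B\<close> yields an \<open>x\<close> at which that candidate
      fails.\<close>
    have y: "(axis undefined 1 :: 'k ^ 'n) \<noteq> 0" (is "?y \<noteq> 0")
      by (simp add: axis_eq_0_iff)
    obtain x where "frame_form f J x \<noteq> frame_form f J ?y / (norm ?y)\<^sup>2 * (norm x)\<^sup>2"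
      using J unfolding B_def by blast
    then have "h J (x, ?y) \<noteq> 0"
      using y by (simp add: h_def field_simps)
    then show "\<exists>z. h J z \<noteq> 0" ..
  qed
  then obtain z where z: "\<And>J. J \<in> B \<Longrightarrow> h J z \<noteq> 0"
    by blast
  show thesis
  proof (rule that[of "fst z" "snd z"])
    fix J
    assume "J \<subseteq> I"
      and "frame_form f J (fst z) * (norm (snd z))\<^sup>2 = frame_form f J (snd z) * (norm (fst z))\<^sup>2"
    then have "J \<subseteq> I" "J \<notin> B"
      using z[of J] by (auto simp: h_def)
    then show "\<exists>c. \<forall>v. frame_form f J v = c * (norm v)\<^sup>2"
      unfolding B_def by blast
  qed
qed

subsection \<open>Factor posets of projected frames\<close>

text \<open>The residual \<open>x - p x\<close> is orthogonal to every \<open>f j\<close>, so the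
  form vanishes there, and \<open>c > 0\<close> forces the residual to be 0.\<close>

lemma span_UNIV_of_frame_form:
  fixes f :: "'i \<Rightarrow> 'k::rc_field ^ 'n"
  assumes "finite J" "c > 0" "\<And>x. frame_form f J x = c * (norm x)\<^sup>2"
  shows "vec.span (f ` J) = UNIV"
proof -
  obtain p :: "'k ^ 'n \<Rightarrow> 'k ^ 'n"
    where p: "orthogonal_projection p" and rp: "range p = vec.span (f ` J)"
    using orthogonal_projection_onto_span[of "f ` J"] assms(1) by blast
  have "p x = x" for x
  proof -
    have "hinner (x - p x) (f j) = 0" if "j \<in> J" for j
    proof -
      have "f j \<in> range p"
        using that rp by (simp add: vec.span_base)
      then have "p (f j) = f j"
        by (rule orthogonal_projection_fixes_range[OF p])
      then show ?thesis
        using p by (simp add: hinner_diff_left orthogonal_projection_def)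
    qed
    then have "frame_form f J (x - p x) = 0"
      by (simp add: frame_form_def)
    then show ?thesis
      using assms(2,3) by simp
  qed
  then show ?thesis
    using rp by (metis UNIV_I rangeI subset_antisym subsetI)
qed

lemma frame_form_projected:
  assumes "orthogonal_projection p" "x \<in> range p"
  shows "frame_form (p \<circ> f) J x = frame_form f J x"
  using assms by (simp add: frame_form_def hinner_projected)

lemma is_tight_frame_frame_form:
  "is_tight_frame V J f \<longleftrightarrow>
    is_frame V J f \<and> (\<exists>c>0. \<forall>x\<in>V. frame_form f J x = c * (norm x)\<^sup>2)"
  by (simp add: is_tight_frame_def frame_form_def)

lemma exists_projection_same_factor_poset:
  fixes f :: "'i \<Rightarrow> 'k::rc_field ^ 'n"
  assumes l: "2 \<le> l" "l \<le> CARD('n)" and f: "is_frame UNIV I f"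
  shows "\<exists>p. orthogonal_projection p \<and> vec.dim (range p) = l \<and> is_frame (range p) I (p \<circ> f)
    \<and> factor_poset (range p) I (p \<circ> f) = factor_poset UNIV I f"
proof -
  have fin: "finite I" and sp: "vec.span (f ` I) = UNIV"
    using f by (auto simp: is_frame_def)
  obtain x y where xy: "\<And>J. J \<subseteq> I \<Longrightarrow>
      frame_form f J x * (norm y)\<^sup>2 = frame_form f J y * (norm x)\<^sup>2 \<Longrightarrow>
      \<exists>c. \<forall>v. frame_form f J v = c * (norm v)\<^sup>2"
    using common_separating_pair[OF fin] by metis
  obtain p where p: "orthogonal_projection p" and dim: "vec.dim (range p) = l"
    and xyp: "x \<in> range p" "y \<in> range p"
    using exists_projection_range_contains[OF l] by metis
  have "is_tight_frame (range p) J (p \<circ> f) \<longleftrightarrow> is_tight_frame UNIV J f" if J: "J \<subseteq> I" for J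
  proof
    assume "is_tight_frame (range p) J (p \<circ> f)"
    then obtain c where c: "c > 0" and "\<forall>v\<in>range p. frame_form (p \<circ> f) J v = c * (norm v)\<^sup>2"
      unfolding is_tight_frame_frame_form by blast
    then have q: "frame_form f J v = c * (norm v)\<^sup>2" if "v \<in> range p" for v
      using that frame_form_projected[OF p, of v f J] by metis
    \<comment> \<open>Both \<open>x\<close> and \<open>y\<close> lie in \<open>range p\<close>, so
      both sides of the separating equation equal \<open>c\<close> times the product of the squared
      norms.\<close>
    obtain c' where c': "\<And>v. frame_form f J v = c' * (norm v)\<^sup>2"
      using xy[OF J] q xyp by auto
    \<comment> \<open>A nonzero vector of the range identifies \<open>c'\<close> with
      \<open>c\<close>, which makes \<open>c'\<close> positive.\<close>
    have "\<not> range p \<subseteq> {0}"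
      using dim l vec.dim_eq_0[of "range p"] by auto
    then obtain v where "v \<in> range p" "v \<noteq> 0"
      by blast
    then have "c' = c"
      using q c' by (metis mult_right_cancel norm_eq_zero power_eq_0_iff)
    moreover have "finite J"
      using J fin finite_subset by blast
    ultimately show "is_tight_frame UNIV J f"
      using span_UNIV_of_frame_form[of J c f] c c'
      by (auto simp: is_tight_frame_frame_form is_frame_def)
  next
    assume "is_tight_frame UNIV J f"
    then show "is_tight_frame (range p) J (p \<circ> f)"
      using orthogonal_projection_span_image[OF p, of f J] frame_form_projected[OF p]
      unfolding is_tight_frame_frame_form is_frame_def by (metis UNIV_I)
  qed
  then have "factor_poset (range p) I (p \<circ> f) = factor_poset UNIV I f"
    by (auto simp: factor_poset_def)
  moreover have "is_frame (range p) I (p \<circ> f)"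
    using orthogonal_projection_span_image[OF p sp] fin by (simp add: is_frame_def)
  ultimately show ?thesis
    using p dim by blast
qed

theorem theorem9:
  fixes I :: "'i set" and f :: "'i \<Rightarrow> real ^ 'n" and g :: "'i \<Rightarrow> complex ^ 'n" and l :: nat
  assumes "2 \<le> l" and "l \<le> CARD('n)"
  shows "(is_frame UNIV I f \<and> (\<forall>i\<in>I. f i \<noteq> 0) \<longrightarrow>
            (\<exists>p. orthogonal_projection p \<and> vec.dim (range p) = l \<and>
                 is_frame (range p) I (p \<circ> f) \<and>
                 factor_poset (range p) I (p \<circ> f) = factor_poset UNIV I f)) \<and>
         (is_frame UNIV I g \<and> (\<forall>i\<in>I. g i \<noteq> 0) \<longrightarrow>
            (\<exists>p. orthogonal_projection p \<and> vec.dim (range p) = l \<and>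
                 is_frame (range p) I (p \<circ> g) \<and>
                 factor_poset (range p) I (p \<circ> g) = factor_poset UNIV I g))"
  using exists_projection_same_factor_poset[OF assms, of I f]
    exists_projection_same_factor_poset[OF assms, of I g]
  by blast

end
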